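(* Any $\mathsf{LCL}$ problem $\Pi$ that has a certificate for $O(1)$ solvability is solvable in a constant number of rounds (on full $\delta$-ary rooted trees) by a deterministic $\mathsf{CONGEST}$ algorithm.
   Context: An $\mathsf{LCL}$ problem is a triple $\Pi=(\delta,\Sigma(\Pi),\mathcal C(\Pi))$ where $\delta\ge 1$ is an integer, $\Sigma(\Pi)$ is a finite set of labels, and $\mathcal C(\Pi)\subseteq\Sigma(\Pi)^{\delta+1}$ is a set of allowed configurations, written $(a:b_1,\dots,b_\delta)$; the order of $b_1,\dots,b_\delta$ is irrelevant. Inputs are unlabeled full $\delta$-ary rooted trees (every node has exactly $\delta$ or $0$ children). A labeling $\lambda$ of the nodes of a tree by $\Sigma(\Pi)$ is correct (a solution) if for every node $v$ with $\delta$ children $v_1,\dots,v_\delta$ there is a permutation $\rho$ of $\{1,\dots,\delta\}$ with $(\lambda(v):\lambda(v_{\rho(1)}),\dots,\lambda(v_{\rho(\delta)}))\in\mathcal C(\Pi)$; leaves are unconstrained. Certificate for $O(\log^* n)$ solvability: a nonempty label set $\Sigma_{\mathcal T}=\{\sigma_1,\dots,\sigma_t\}\subseteq\Sigma(\Pi)$, a depth $d\ge 1$, and labeled trees $\mathcal T=(\mathcal T_1,\dots,\mathcal T_t)$ such that (1) each $\mathcal T_i$ is a complete $\delta$-ary tree of depth $d$ (every non-leaf has $\delta$ children, all leaves at distance $d$ from the root); (2) each $\mathcal T_i$ is labeled with labels from $\Sigma_{\mathcal T}$ and is correct with respect to $\mathcal C(\Pi)$; (3) the trees obtained from the $\mathcal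 T_i$ by erasing the labels of all non-leaf nodes are all isomorphic as rooted trees with labeled leaves; (4) the root of $\mathcal T_i$ is labeled $\sigma_i$. Certificate for $O(1)$ solvability: a pair consisting of a certificate $\mathcal T$ for $O(\log^* n)$ solvability and a configuration $(a:b_1,\dots,a,\dots,b_\delta)\in\mathcal C(\Pi)$ (i.e. the parent label $a$ also occurs among the child labels) such that all labels of the configuration lie in $\Sigma_{\mathcal T}$ and at least one leaf of the trees in $\mathcal T$ is labeled $a$. Model. In deterministic $\mathsf{CONGEST}$ on an $n$-node graph each node has a unique identifier from $\{1,\dots,\mathrm{poly}(n)\}$ and initially knows its identifier, its degree, $n$, the maximum degree, and which incident edge leads to its parent. In synchronous rounds nodes exchange $O(\log n)$-bit messages with neighbors and do unbounded local computation; each node eventually outputs its label. The running time is the number of rounds until all nodes have output; "constant" means bounded by a number depending only on $\Pi$. *)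

theory Defs
  imports Complex_Main
begin

section \<open>Rooted trees\<close>

text \<open>The value of \<open>parent\<close> at the root and outside \<open>verts\<close> is irrelevant.\<close>

record 'v rtree =
  verts :: "'v set"
  root :: 'v
  parent :: "'v \<Rightarrow> 'v"

definition rooted_tree :: "'v rtree \<Rightarrow> bool" where
  "rooted_tree G \<longleftrightarrow>
     finite (verts G) \<and> root G \<in> verts G \<and>
     (\<forall>v \<in> verts G - {root G}. parent G v \<in> verts G) \<and>
     (\<forall>v \<in> verts G. \<exists>k. (parent G ^^ k) v = root G)"

definition children :: "'v rtree \<Rightarrow> 'v \<Rightarrow> 'v set" where
  "children G v = {u \<in> verts G - {root G}. parent G u = v}"

definition leaf :: "'v rtree \<Rightarrow> 'v \<Rightarrow> bool" where
  "leaf G v \<longleftrightarrow> v \<in> verts G \<and> children G v = {}"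

definition depth :: "'v rtree \<Rightarrow> 'v \<Rightarrow> nat" where
  "depth G v = (LEAST k. (parent G ^^ k) v = root G)"

definition full_tree :: "nat \<Rightarrow> 'v rtree \<Rightarrow> bool" where
  "full_tree \<delta> G \<longleftrightarrow>
     rooted_tree G \<and> (\<forall>v \<in> verts G. card (children G v) = \<delta> \<or> card (children G v) = 0)"

definition complete_tree :: "nat \<Rightarrow> nat \<Rightarrow> 'v rtree \<Rightarrow> bool" where
  "complete_tree \<delta> d G \<longleftrightarrow>
     rooted_tree G \<and>
     (\<forall>v \<in> verts G. \<not> leaf G v \<longrightarrow> card (children G v) = \<delta>) \<and>
     (\<forall>v. leaf G v \<longrightarrow> depth G v = d)"

definition labeled_iso ::
  "'v rtree \<Rightarrow> ('v \<Rightarrow> 'b) \<Rightarrow> 'w rtree \<Rightarrow> ('w \<Rightarrow> 'b) \<Rightarrow> bool" where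
  "labeled_iso G l H m \<longleftrightarrow>
     (\<exists>f. bij_betw f (verts G) (verts H) \<and> f (root G) = root H \<and>
          (\<forall>v \<in> verts G - {root G}. f (parent G v) = parent H (f v)) \<and>
          (\<forall>v \<in> verts G. m (f v) = l v))"

definition erase_inner :: "'v rtree \<Rightarrow> ('v \<Rightarrow> 'l) \<Rightarrow> 'v \<Rightarrow> 'l option" where
  "erase_inner G l v = (if leaf G v then Some (l v) else None)"


section \<open>LCL problems\<close>

text \<open>A pair \<open>(a, [b\<^sub>1, \<dots>, b\<^sub>\<delta>])\<close> in \<open>configs\<close> stands for the configuration
  \<open>(a : b\<^sub>1, \<dots>, b\<^sub>\<delta>)\<close>.\<close>

record 'l lcl =
  arity :: nat
  labels :: "'l set"
  configs :: "('l \<times> 'l list) set"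

definition lcl_problem :: "'l lcl \<Rightarrow> bool" where
  "lcl_problem P \<longleftrightarrow>
     arity P \<ge> 1 \<and> finite (labels P) \<and>
     (\<forall>(a, bs) \<in> configs P. a \<in> labels P \<and> length bs = arity P \<and> set bs \<subseteq> labels P)"

text \<open>The children of a node are unordered, so a permutation of them is just an enumeration
  \<open>vs\<close> without repetition.\<close>

definition solution :: "'l lcl \<Rightarrow> 'v rtree \<Rightarrow> ('v \<Rightarrow> 'l) \<Rightarrow> bool" where
  "solution P G l \<longleftrightarrow>
     (\<forall>v \<in> verts G. l v \<in> labels P) \<and>
     (\<forall>v \<in> verts G. card (children G v) = arity P \<longrightarrow>
        (\<exists>vs. distinct vs \<and> set vs = children G v \<and> (l v, map l vs) \<in> configs P))"


section \<open>Certificates\<close>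

text \<open>The trees \<open>\<T>\<^sub>i\<close> are indexed by their root label \<open>\<sigma>\<^sub>i\<close> instead of by \<open>i\<close>:
  \<open>\<T> \<sigma>\<close> is the tree with root label \<open>\<sigma>\<close>, and \<open>lab \<sigma>\<close> is its labeling. Vertices are natural
  numbers, which is no restriction for finite trees up to isomorphism.\<close>

definition log_star_certificate ::
  "'l lcl \<Rightarrow> 'l set \<Rightarrow> nat \<Rightarrow> ('l \<Rightarrow> nat rtree) \<Rightarrow> ('l \<Rightarrow> nat \<Rightarrow> 'l) \<Rightarrow> bool" where
  "log_star_certificate P S d \<T> lab \<longleftrightarrow>
     S \<noteq> {} \<and> S \<subseteq> labels P \<and> d \<ge> 1 \<and>
     (\<forall>\<sigma> \<in> S. complete_tree (arity P) d (\<T> \<sigma>)) \<and>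
     (\<forall>\<sigma> \<in> S. (\<forall>v \<in> verts (\<T> \<sigma>). lab \<sigma> v \<in> S) \<and> solution P (\<T> \<sigma>) (lab \<sigma>)) \<and>
     (\<forall>\<sigma> \<in> S. \<forall>\<tau> \<in> S.
        labeled_iso (\<T> \<sigma>) (erase_inner (\<T> \<sigma>) (lab \<sigma>)) (\<T> \<tau>) (erase_inner (\<T> \<tau>) (lab \<tau>))) \<and>
     (\<forall>\<sigma> \<in> S. lab \<sigma> (root (\<T> \<sigma>)) = \<sigma>)"

definition constant_certificate ::
  "'l lcl \<Rightarrow> 'l set \<Rightarrow> nat \<Rightarrow> ('l \<Rightarrow> nat rtree) \<Rightarrow> ('l \<Rightarrow> nat \<Rightarrow> 'l) \<Rightarrow> 'l \<times> 'l list \<Rightarrow> bool" where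
  "constant_certificate P S d \<T> lab = (\<lambda>(a, bs).
     log_star_certificate P S d \<T> lab \<and>
     (a, bs) \<in> configs P \<and> a \<in> set bs \<and> insert a (set bs) \<subseteq> S \<and>
     (\<exists>\<sigma> \<in> S. \<exists>v. leaf (\<T> \<sigma>) v \<and> lab \<sigma> v = a))"

definition has_constant_certificate :: "'l lcl \<Rightarrow> bool" where
  "has_constant_certificate P \<longleftrightarrow> (\<exists>S d \<T> lab conf. constant_certificate P S d \<T> lab conf)"


section \<open>The deterministic CONGEST model on rooted trees\<close>

text \<open>The edges at a node \<open>v\<close> are numbered by ports \<open>0, \<dots>, degree v - 1\<close>; \<open>port N v p\<close> is the
  neighbour of \<open>v\<close> behind port \<open>p\<close>. The numbering is arbitrary, and the numbers at the two ends
  of an edge are unrelated. Algorithms see identifiers and ports but not vertex names, so taking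
  natural numbers as vertex names is no restriction.\<close>

record network =
  tree :: "nat rtree"
  ident :: "nat \<Rightarrow> nat"
  port :: "nat \<Rightarrow> nat \<Rightarrow> nat"

definition neighbours :: "'v rtree \<Rightarrow> 'v \<Rightarrow> 'v set" where
  "neighbours G v = children G v \<union> (if v = root G then {} else {parent G v})"

definition degree :: "'v rtree \<Rightarrow> 'v \<Rightarrow> nat" where
  "degree G v = card (neighbours G v)"

definition max_degree :: "'v rtree \<Rightarrow> nat" where
  "max_degree G = Max (degree G ` verts G)"

definition port_to :: "network \<Rightarrow> nat \<Rightarrow> nat \<Rightarrow> nat" where
  "port_to N u v = (THE p. p < degree (tree N) u \<and> port N u p = v)"

text \<open>The exponent \<open>c\<close> makes the bound on the identifiers polynomial.\<close>

definition valid_network :: "nat \<Rightarrow> nat \<Rightarrow> network \<Rightarrow> bool" where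
  "valid_network \<delta> c N \<longleftrightarrow>
     full_tree \<delta> (tree N) \<and>
     inj_on (ident N) (verts (tree N)) \<and>
     ident N ` verts (tree N) \<subseteq> {1..card (verts (tree N)) ^ c} \<and>
     (\<forall>v \<in> verts (tree N). bij_betw (port N v) {..<degree (tree N) v} (neighbours (tree N) v))"

text \<open>Initial knowledge of a node; \<open>parent_port\<close> is \<open>None\<close> exactly at the root.\<close>

record local_info =
  own_ident :: nat
  own_degree :: nat
  num_nodes :: nat
  known_max_degree :: nat
  parent_port :: "nat option"

definition local_info :: "network \<Rightarrow> nat \<Rightarrow> local_info" where
  "local_info N v =
     \<lparr> own_ident = ident N v,
       own_degree = degree (tree N) v,
       num_nodes = card (verts (tree N)),
       known_max_degree = max_degree (tree N),
       parent_port =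
         (if v = root (tree N) then None else Some (port_to N v (parent (tree N) v))) \<rparr>"

text \<open>Messages are bit strings. In each round a node sends a message through every port (the
  empty string plays the role of no message) and updates its state using the list of received
  messages, ordered by port. A node has output once \<open>out\<close> is no longer \<open>None\<close>.
  Arbitrary functions are allowed, since local computation is unbounded.\<close>

record ('s, 'l) algorithm =
  init :: "local_info \<Rightarrow> 's"
  send :: "'s \<Rightarrow> nat \<Rightarrow> bool list"
  update :: "'s \<Rightarrow> bool list list \<Rightarrow> 's"
  out :: "'s \<Rightarrow> 'l option"

primrec state :: "('s, 'l) algorithm \<Rightarrow> network \<Rightarrow> nat \<Rightarrow> nat \<Rightarrow> 's" where
  "state A N 0 = (\<lambda>v. init A (local_info N v))"
| "state A N (Suc t) = (\<lambda>v. update A (state A N t v)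
     (map (\<lambda>p. let u = port N v p in send A (state A N t u) (port_to N u v))
          [0..<degree (tree N) v]))"

definition bandwidth_bounded :: "('s, 'l) algorithm \<Rightarrow> network \<Rightarrow> nat \<Rightarrow> bool" where
  "bandwidth_bounded A N B \<longleftrightarrow>
     (\<forall>t. \<forall>v \<in> verts (tree N). \<forall>p < degree (tree N) v.
        real (length (send A (state A N t v) p)) \<le> real B * log 2 (real (card (verts (tree N)))))"

definition has_output :: "('s, 'l) algorithm \<Rightarrow> network \<Rightarrow> nat \<Rightarrow> nat \<Rightarrow> bool" where
  "has_output A N t v \<longleftrightarrow> out A (state A N t v) \<noteq> None"

definition finishes_within :: "('s, 'l) algorithm \<Rightarrow> network \<Rightarrow> nat \<Rightarrow> bool" where
  "finishes_within A N T \<longleftrightarrow> (\<forall>v \<in> verts (tree N). \<exists>t \<le> T. has_output A N t v)"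

text \<open>An output is irrevocable: the first one counts.\<close>

definition output_label :: "('s, 'l) algorithm \<Rightarrow> network \<Rightarrow> nat \<Rightarrow> 'l" where
  "output_label A N v = the (out A (state A N (LEAST t. has_output A N t v) v))"

text \<open>The algorithm and the constant \<open>B\<close> in the \<open>O(log n)\<close> message bound may depend on the
  identifier range, but the number of rounds \<open>T\<close> may not. Using natural numbers as states is no
  restriction: a state may as well be a code of the initial knowledge and all messages received
  so far, which range over countable types.\<close>

definition congest_solvable_in :: "'l lcl \<Rightarrow> nat \<Rightarrow> bool" where
  "congest_solvable_in P T \<longleftrightarrow>
     (\<forall>c. \<exists>(A :: (nat, 'l) algorithm) B. \<forall>N. valid_network (arity P) c N \<longrightarrow>
        bandwidth_bounded A N B \<and> finishes_within A N T \<and>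
        solution P (tree N) (output_label A N))"

end

theory Submission
  imports Defs "HOL-Library.Countable" "HOL-Library.Multiset" "HOL-Combinatorics.Transposition"
begin

text \<open>
  Port numbers give every node an address, the sequence of the letters in \<open>{..<\<delta>}\<close> on its path to
  the root; above the root, the address is padded with zeros. It suffices to find a labeling of
  all infinite addresses that depends only on a bounded number of letters and is correct at every
  node, since each node can collect these letters in constantly many rounds.

  By the certificate, complete trees of depth \<open>d\<close> with any root label can be completed so that
  the leaf labels do not depend on the root label. So if the paths are cut, at gaps of at least
  \<open>d\<close>, at nodes that can be recognised locally, then labels are known locally from the first full
  block of \<open>d\<close> levels after a cut. Cuts are strict local minima of a coloring by address
  windows. This coloring breaks symmetry except at heavy nodes, whose address is periodic with
  a period at most \<open>d\<close>. Every node has at most one heavy child. Ordering it first, and choosing the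
  order in the certificate trees such that the leftmost leaf is labeled \<open>a\<close>, ensures that a block
  along a long heavy path ends in \<open>a\<close>, and from there on the configuration
  \<open>(a : a, \<dots>)\<close> is repeated.
\<close>

text \<open>Child labels form a multiset because children are unordered;
  \<open>ordered_config_iff\<close> leads back to the enumerations in
  \<open>solution\<close>.\<close>

definition perm_config :: "'l lcl \<Rightarrow> 'l \<Rightarrow> 'l multiset \<Rightarrow> bool" where
  "perm_config P a M \<longleftrightarrow> (\<exists>bs. (a, bs) \<in> configs P \<and> mset bs = M)"

section \<open>Local labelings of addresses\<close>

text \<open>Addresses and words are read upwards: position 0 is the letter of the node itself.\<close>

definition anc :: "nat \<Rightarrow> (nat \<Rightarrow> nat) \<Rightarrow> nat \<Rightarrow> nat" where
  "anc k x = (\<lambda>i. x (i + k))"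

lemma anc_apply: "anc k x i = x (i + k)"
  by (simp add: anc_def)

lemma anc_0 [simp]: "anc 0 x = x"
  by (simp add: anc_def)

lemma anc_anc [simp]: "anc j (anc k x) = anc (j + k) x"
  by (simp add: anc_def add.assoc)

text \<open>Throughout, \<open>case_nat q x\<close> serves as the address of the child with letter
  \<open>q\<close> below address \<open>x\<close>.\<close>

lemma anc_case_nat [simp]: "anc (Suc 0) (case_nat q x) = x"
  by (simp add: anc_def)

definition words :: "nat \<Rightarrow> (nat \<Rightarrow> nat) set" where
  "words \<delta> = {x. \<forall>i. x i < \<delta>}"

lemma anc_words: "x \<in> words \<delta> \<Longrightarrow> anc k x \<in> words \<delta>"
  by (simp add: words_def anc_apply)

lemma case_nat_words: "q < \<delta> \<Longrightarrow> x \<in> words \<delta> \<Longrightarrow> case_nat q x \<in> words \<delta>"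
  by (auto simp: words_def split: nat.splits)

definition agree :: "nat \<Rightarrow> (nat \<Rightarrow> nat) \<Rightarrow> (nat \<Rightarrow> nat) \<Rightarrow> bool" where
  "agree n x y \<longleftrightarrow> (\<forall>i<n. x i = y i)"

lemma agreeD: "agree n x y \<Longrightarrow> i < n \<Longrightarrow> x i = y i"
  by (simp add: agree_def)

lemma agree_anc: "agree n x y \<Longrightarrow> m + k \<le> n \<Longrightarrow> agree m (anc k x) (anc k y)"
  by (simp add: agree_def anc_apply)

lemma agree_mono: "agree n x y \<Longrightarrow> m \<le> n \<Longrightarrow> agree m x y"
  by (simp add: agree_def)

section \<open>Periodic addresses and the order of siblings\<close>

text \<open>These are the addresses whose window of \<open>d + 1\<close> letters recurs at an
  ancestor at distance at most \<open>d\<close>, so that \<open>color\<close> fails to separate the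
  two.\<close>

definition heavy :: "nat \<Rightarrow> (nat \<Rightarrow> nat) \<Rightarrow> bool" where
  "heavy d x \<longleftrightarrow> (\<exists>p\<in>{1..d}. \<forall>i\<le>d. x i = x (i + p))"

text \<open>If both continuations \<open>x\<close> and \<open>y\<close> of a common tail are periodic, with periods \<open>p\<close> and \<open>q\<close>,
  then \<open>x 0\<close> and \<open>y 0\<close> both equal the letter at position \<open>p + q\<close>.\<close>

lemma heavy_unique:
  assumes "heavy d x" "heavy d y" "anc 1 x = anc 1 y"
  shows "x 0 = y 0"
proof -
  obtain p where p: "1 \<le> p" "p \<le> d" "\<And>i. i \<le> d \<Longrightarrow> x i = x (i + p)"
    using assms(1) by (auto simp: heavy_def)
  obtain q where q: "1 \<le> q" "q \<le> d" "\<And>i. i \<le> d \<Longrightarrow> y i = y (i + q)"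
    using assms(2) by (auto simp: heavy_def)
  have eq: "x i = y i" if "i \<ge> 1" for i
    using fun_cong[OF assms(3), of "i - 1"] that by (simp add: anc_apply)
  have "x 0 = x p" using p(3)[of 0] by simp
  also have "\<dots> = y (p + q)" using q(3)[of p] eq p by simp
  also have "\<dots> = x (q + p)" using eq[of "p + q"] p by (simp add: add.commute)
  also have "\<dots> = y q" using p(3)[of q] eq q by simp
  also have "\<dots> = y 0" using q(3)[of 0] by simp
  finally show ?thesis .
qed

lemma heavy_agree: "agree (2 * d + 1) x y \<Longrightarrow> heavy d x \<longleftrightarrow> heavy d y"
  unfolding heavy_def by (intro bex_cong refl all_cong1 imp_cong) (auto simp: agree_def)

text \<open>At most one child is heavy by \<open>heavy_unique\<close>, so \<open>LEAST\<close> only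
  picks it out. The default 0 makes the swap in \<open>canon\<close> the identity.\<close>

definition designated :: "nat \<Rightarrow> nat \<Rightarrow> (nat \<Rightarrow> nat) \<Rightarrow> nat" where
  "designated \<delta> d x =
     (if \<exists>q<\<delta>. heavy d (case_nat q x) then LEAST q. q < \<delta> \<and> heavy d (case_nat q x) else 0)"

lemma designated_less: "\<delta> > 0 \<Longrightarrow> designated \<delta> d x < \<delta>"
proof (cases "\<exists>q<\<delta>. heavy d (case_nat q x)")
  case True
  then show ?thesis unfolding designated_def
    using LeastI_ex[of "\<lambda>q. q < \<delta> \<and> heavy d (case_nat q x)"] by auto
qed (auto simp: designated_def)

lemma case_nat_anc: "case_nat (x 0) (anc (Suc 0) x) = x"
  by (rule ext) (auto simp: anc_apply split: nat.splits)

lemma designated_heavy: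
  assumes "x \<in> words \<delta>" "heavy d x"
  shows "designated \<delta> d (anc 1 x) = x 0"
proof -
  let ?y = "anc 1 x"
  have ex: "x 0 < \<delta> \<and> heavy d (case_nat (x 0) ?y)"
    using assms by (simp add: words_def case_nat_anc)
  have "heavy d (case_nat (LEAST q. q < \<delta> \<and> heavy d (case_nat q ?y)) ?y)"
    using LeastI[of "\<lambda>q. q < \<delta> \<and> heavy d (case_nat q ?y)", OF ex] by simp
  from heavy_unique[OF this assms(2)] ex show ?thesis
    by (auto simp: designated_def)
qed

lemma designated_agree:
  assumes "agree (2 * d) x y"
  shows "designated \<delta> d x = designated \<delta> d y"
proof -
  have "heavy d (case_nat q x) \<longleftrightarrow> heavy d (case_nat q y)" for q
    by (rule heavy_agree) (use assms in \<open>auto simp: agree_def split: nat.splits\<close>)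
  then show ?thesis by (auto simp: designated_def)
qed

definition canon :: "nat \<Rightarrow> nat \<Rightarrow> (nat \<Rightarrow> nat) \<Rightarrow> nat" where
  "canon \<delta> d x = transpose 0 (designated \<delta> d (anc 1 x)) (x 0)"

lemma canon_less:
  assumes "x \<in> words \<delta>"
  shows "canon \<delta> d x < \<delta>"
proof -
  have "x 0 < \<delta>" using assms by (simp add: words_def)
  then show ?thesis
    using designated_less[of \<delta> d "anc 1 x"] by (auto simp: canon_def transpose_def)
qed

lemma canon_heavy: "x \<in> words \<delta> \<Longrightarrow> heavy d x \<Longrightarrow> canon \<delta> d x = 0"
  using designated_heavy by (simp add: canon_def)

lemma canon_agree: "agree (2 * d + 1) x y \<Longrightarrow> canon \<delta> d x = canon \<delta> d y"
  using designated_agree[OF agree_anc, of "2 * d + 1" x y d 1]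
  by (simp add: canon_def agree_def)

lemma canon_case_nat: "canon \<delta> d (case_nat q x) = transpose 0 (designated \<delta> d x) q"
  by (simp add: canon_def)

text \<open>On the children of one node, \<open>canon\<close> is a transposition of
  \<open>{..<\<delta>}\<close>, so moving the heavy child to index 0 does not affect
  configurations.\<close>

lemma image_canon:
  assumes "\<delta> > 0"
  shows "image_mset (\<lambda>q. f (canon \<delta> d (case_nat q x))) (mset_set {..<\<delta>}) =
         image_mset f (mset_set {..<\<delta>})"
proof -
  let ?\<pi> = "transpose 0 (designated \<delta> d x)"
  have "image_mset ?\<pi> (mset_set {..<\<delta>}) = mset_set (?\<pi> ` {..<\<delta>})"
    by (rule image_mset_mset_set) simp
  also have "?\<pi> ` {..<\<delta>} = {..<\<delta>}"
    using assms designated_less[OF assms, of d x] by simp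
  finally have "image_mset f (mset_set {..<\<delta>}) = image_mset f (image_mset ?\<pi> (mset_set {..<\<delta>}))"
    by simp
  then show ?thesis by (simp add: canon_case_nat multiset.map_comp comp_def)
qed

section \<open>Colors and local cuts\<close>

definition color :: "nat \<Rightarrow> (nat \<Rightarrow> nat) \<Rightarrow> nat" where
  "color d x = to_nat (map x [0..<Suc d])"

lemma color_eq_iff: "color d x = color d y \<longleftrightarrow> (\<forall>i\<le>d. x i = y i)"
  unfolding color_def by (auto simp del: upt_Suc simp: less_Suc_eq_le)

lemma color_bounded: "\<exists>C. \<forall>x\<in>words \<delta>. color d x \<le> C"
proof -
  let ?W = "{xs. set xs \<subseteq> {..<\<delta>} \<and> length xs = Suc d}"
  have fin: "finite (to_nat ` ?W)" by (intro finite_imageI finite_lists_length_eq) simp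
  have "color d x \<le> Max (to_nat ` ?W)" if "x \<in> words \<delta>" for x
    unfolding color_def
    by (rule Max_ge[OF fin], rule imageI) (use that in \<open>auto simp: words_def simp del: upt_Suc\<close>)
  then show ?thesis by blast
qed

lemma color_neq:
  assumes "\<not> heavy d x" "1 \<le> p" "p \<le> d"
  shows "color d x \<noteq> color d (anc p x)"
  using assms by (auto simp: heavy_def color_eq_iff anc_apply)

text \<open>The window of the lower, light node cannot recur within distance \<open>d\<close>. Hence
  a weak inequality between colors of nearby light nodes is strict.\<close>

lemma color_neq_light:
  assumes "\<not> heavy d (anc i x)" "\<not> heavy d (anc j x)" "i \<noteq> j" "i \<le> j + d" "j \<le> i + d"
  shows "color d (anc i x) \<noteq> color d (anc j x)"
proof (cases "i < j")
  case True
  then show ?thesis using color_neq[OF assms(1), of "j - i"] assms by simp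
next
  case False
  then have "1 \<le> i - j" "i - j \<le> d" "i - j + j = i" using assms(3,4) by auto
  with color_neq[OF assms(2), of "i - j"] show ?thesis by simp
qed

text \<open>The local minimum is at the ancestor at distance \<open>d\<close>, so that the \<open>d\<close> positions below it on
  the path are part of the address and no node has to look at its descendants.\<close>

definition reset :: "nat \<Rightarrow> (nat \<Rightarrow> nat) \<Rightarrow> bool" where
  "reset d x \<longleftrightarrow> \<not> heavy d (anc d x) \<and>
     (\<forall>i\<le>2 * d. i \<noteq> d \<longrightarrow> \<not> heavy d (anc i x) \<longrightarrow> color d (anc d x) < color d (anc i x))"

text \<open>At distance at most \<open>d\<close>, each of the two minima lies in the comparison
  window of the other, so each color would be smaller than the other.\<close>

lemma reset_gap:
  assumes "reset d x" "reset d (anc k x)" "k \<ge> 1"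
  shows "k > d"
proof (rule ccontr)
  assume "\<not> d < k"
  then have k: "k \<le> d" by simp
  have "color d (anc d x) < color d (anc (d + k) x)"
    using assms k unfolding reset_def by auto
  moreover have "color d (anc (d + k) x) < color d (anc d x)"
  proof -
    have "d - k \<le> 2 * d" "d - k \<noteq> d" "anc (d - k) (anc k x) = anc d x" using assms(3) k by auto
    then show ?thesis using assms(1,2) unfolding reset_def by (metis anc_anc)
  qed
  ultimately show False by simp
qed

lemma reset_agree:
  assumes "agree (4 * d + 1) x y"
  shows "reset d x \<longleftrightarrow> reset d y"
proof -
  have h: "heavy d (anc i x) \<longleftrightarrow> heavy d (anc i y)" if "i \<le> 2 * d" for i
    by (rule heavy_agree, rule agree_anc[OF assms]) (use that in simp)
  have c: "color d (anc i x) = color d (anc i y)" if "i \<le> 2 * d" for i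
    unfolding color_eq_iff using agreeD[OF assms] that by (simp add: anc_apply)
  show ?thesis unfolding reset_def using h c by auto
qed

text \<open>Descending to smaller and smaller colors reaches a strict local minimum.\<close>

lemma reset_below:
  assumes "\<not> heavy d (anc i x)" "color d (anc i x) = n" "(n + 1) * d \<le> i"
  shows "\<exists>j\<le>i + n * d. reset d (anc j x)"
  using assms
proof (induction n arbitrary: i rule: less_induct)
  case (less n i)
  have di: "d \<le> i" using less.prems(3) by simp
  show ?case
  proof (cases "reset d (anc (i - d) x)")
    case True
    moreover have "i - d \<le> i + n * d" by simp
    ultimately show ?thesis by blast
  next
    case False
    \<comment> \<open>If position \<open>i\<close> is no strict minimum, some light competitor
      within distance \<open>d\<close> has a color that is no larger, hence smaller by
      \<open>color_neq_light\<close>.\<close>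
    then obtain k where k: "k \<le> 2 * d" "k \<noteq> d" "\<not> heavy d (anc (k + (i - d)) x)"
      "color d (anc (k + (i - d)) x) \<le> color d (anc i x)"
      using less.prems(1) di unfolding reset_def by (auto simp: not_less)
    let ?i = "k + (i - d)"
    have "color d (anc ?i x) \<noteq> color d (anc i x)"
      using color_neq_light[OF k(3) less.prems(1)] k(1,2) di by auto
    then have lt: "color d (anc ?i x) < n" using k(4) less.prems(2) by simp
    let ?n = "color d (anc ?i x)"
    \<comment> \<open>The drop in color pays for the at most \<open>d\<close> levels moved, both in
      the room needed below and in the bound on \<open>j\<close>.\<close>
    have le: "(?n + 1) * d \<le> n * d" using lt by (intro mult_le_mono1) simp
    then have "(?n + 1) * d \<le> ?i" using less.prems(3) di by (simp add: algebra_simps)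
    from less.IH[OF lt k(3) refl this] obtain j where "j \<le> ?i + ?n * d" "reset d (anc j x)" by blast
    moreover have "?i + ?n * d \<le> i + n * d" using le k(1) di by (simp add: algebra_simps)
    ultimately show ?thesis using order_trans by blast
  qed
qed

text \<open>Whether a node is a cut is decided at its \<open>d\<close>-th ancestor, so a heavy node
  may still be a cut.\<close>

definition idle :: "nat \<Rightarrow> (nat \<Rightarrow> nat) \<Rightarrow> bool" where
  "idle d x \<longleftrightarrow> heavy d x \<and> \<not> reset d x"

lemma idle_agree: "agree (4 * d + 1) x y \<Longrightarrow> idle d x \<longleftrightarrow> idle d y"
  using heavy_agree[OF agree_mono, of "4 * d + 1" x y d] reset_agree[of d x y]
  by (simp add: idle_def)

lemma reset_or_idle:
  "\<exists>K. \<forall>x\<in>words \<delta>. \<exists>k\<le>K. reset d (anc k x) \<or> (\<forall>i<2 * d. idle d (anc (i + k) x))"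
proof -
  obtain C where C: "\<And>x. x \<in> words \<delta> \<Longrightarrow> color d x \<le> C"
    using color_bounded by blast
  \<comment> \<open>Starting this far up leaves room for the descent in \<open>reset_below\<close>,
    whatever the initial color.\<close>
  let ?n = "(C + 1) * d"
  have "\<exists>k\<le>?n + 3 * d + C * d. reset d (anc k x) \<or> (\<forall>i<2 * d. idle d (anc (i + k) x))"
    if x: "x \<in> words \<delta>" for x
  proof (cases "\<forall>i<3 * d. heavy d (anc (i + ?n) x)")
    case True
    \<comment> \<open>A cut here would require a light node \<open>d\<close> levels above, but that
      node is among the \<open>3 * d\<close> heavy ones.\<close>
    have "idle d (anc (i + ?n) x)" if "i < 2 * d" for i
      using True[rule_format, of i] True[rule_format, of "i + d"] that
      by (auto simp: idle_def reset_def algebra_simps)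
    then show ?thesis by (intro exI[of _ ?n]) simp
  next
    case False
    then obtain i where i: "i < 3 * d" "\<not> heavy d (anc (i + ?n) x)" by blast
    let ?c = "color d (anc (i + ?n) x)"
    have c: "?c \<le> C" using C anc_words[OF x] by blast
    have "?c * d \<le> C * d" using c by (intro mult_le_mono1)
    moreover have "(?c + 1) * d \<le> ?n" using c by (intro mult_le_mono1) simp
    then have "(?c + 1) * d \<le> i + ?n" by (rule trans_le_add2)
    from reset_below[OF i(2) refl this] obtain j where
      "j \<le> i + ?n + ?c * d" "reset d (anc j x)" by blast
    ultimately show ?thesis using i(1) by (intro exI[of _ j]) linarith
  qed
  then show ?thesis by blast
qed

section \<open>Labeling addresses by an automaton\<close>

text \<open>The certificate in coordinates: words are paths in a block, last step first, so
  \<open>j # w\<close> is child \<open>j\<close> of \<open>w\<close>. Index 0, which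
  \<open>canon\<close> gives to heavy nodes, leads to \<open>a\<close> both at the leftmost leaf and
  in the configuration \<open>b\<close>.\<close>

locale uniform_family =
  fixes P :: "'l lcl" and \<delta> d :: nat and S :: "'l set"
    and lab :: "'l \<Rightarrow> nat list \<Rightarrow> 'l" and leaf_label :: "nat list \<Rightarrow> 'l"
    and a :: 'l and b :: "nat \<Rightarrow> 'l"
  assumes d_pos: "d \<ge> 1" and \<delta>_pos: "\<delta> \<ge> 1"
    and lab_Nil: "\<sigma> \<in> S \<Longrightarrow> lab \<sigma> [] = \<sigma>"
    and lab_in: "\<sigma> \<in> S \<Longrightarrow> set w \<subseteq> {..<\<delta>} \<Longrightarrow> length w \<le> d \<Longrightarrow> lab \<sigma> w \<in> S"
    and lab_config: "\<sigma> \<in> S \<Longrightarrow> set w \<subseteq> {..<\<delta>} \<Longrightarrow> length w < d \<Longrightarrow>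
      perm_config P (lab \<sigma> w) (image_mset (\<lambda>j. lab \<sigma> (j # w)) (mset_set {..<\<delta>}))"
    and lab_leaf: "\<sigma> \<in> S \<Longrightarrow> set w \<subseteq> {..<\<delta>} \<Longrightarrow> length w = d \<Longrightarrow> lab \<sigma> w = leaf_label w"
    and leaf_label_0: "leaf_label (replicate d 0) = a"
    and b_in: "j < \<delta> \<Longrightarrow> b j \<in> S" and b_0: "b 0 = a"
    and b_config: "perm_config P a (image_mset b (mset_set {..<\<delta>}))"
begin

definition trail :: "nat \<Rightarrow> (nat \<Rightarrow> nat) \<Rightarrow> nat list" where
  "trail m x = map (\<lambda>i. canon \<delta> d (anc i x)) [0..<m]"

lemma trail_0 [simp]: "trail 0 x = []"
  by (simp add: trail_def)

lemma trail_Suc: "trail (Suc m) x = canon \<delta> d x # trail m (anc (Suc 0) x)"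
  unfolding trail_def map_upt_Suc by simp

lemma length_trail [simp]: "length (trail m x) = m"
  by (simp add: trail_def)

lemma set_trail: "x \<in> words \<delta> \<Longrightarrow> set (trail m x) \<subseteq> {..<\<delta>}"
  by (auto simp: trail_def canon_less anc_words)

text \<open>The path through a full block ending here is then the leftmost one, so its end is
  labeled \<open>a\<close>.\<close>

definition looping :: "(nat \<Rightarrow> nat) \<Rightarrow> bool" where
  "looping x \<longleftrightarrow> (\<forall>i<d. idle d (anc i x))"

lemma looping_idle: "looping x \<Longrightarrow> idle d x"
  using d_pos unfolding looping_def by force

text \<open>The labeling is the output of an automaton that reads an address from the root downwards.
  A state \<open>(\<tau>, m)\<close> means that the node is at level \<open>m < d\<close> of a block whose root is labeled \<open>\<tau>\<close>.\<close>

fun advance :: "'l \<times> nat \<Rightarrow> (nat \<Rightarrow> nat) \<Rightarrow> 'l \<times> nat" where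
  "advance (\<tau>, m) x =
     (if m = 0 \<and> looping (anc (Suc 0) x) then (b (canon \<delta> d x), 0)
      else if Suc m < d then (\<tau>, Suc m) else (leaf_label (trail d x), 0))"

fun label :: "'l \<times> nat \<Rightarrow> (nat \<Rightarrow> nat) \<Rightarrow> 'l" where
  "label (\<tau>, m) x = lab \<tau> (trail m x)"

text \<open>A cut makes the node the root of a new block but keeps the label it has anyway, so the
  configuration at the parent is not disturbed.\<close>

definition step :: "'l \<times> nat \<Rightarrow> (nat \<Rightarrow> nat) \<Rightarrow> 'l \<times> nat" where
  "step s x = (if reset d x then (label (advance s x) x, 0) else advance s x)"

abbreviation legal :: "('l \<times> nat) set" where
  "legal \<equiv> S \<times> {..<d}"

lemma leaf_label_in: "x \<in> words \<delta> \<Longrightarrow> leaf_label (trail d x) \<in> S"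
  using lab_leaf[OF b_in[of 0], of "trail d x"] lab_in[OF b_in[of 0], of "trail d x"] set_trail \<delta>_pos
  by fastforce

lemma advance_legal: "s \<in> legal \<Longrightarrow> x \<in> words \<delta> \<Longrightarrow> advance s x \<in> legal"
  using d_pos by (cases s) (auto simp: b_in canon_less leaf_label_in)

lemma label_in: "s \<in> legal \<Longrightarrow> x \<in> words \<delta> \<Longrightarrow> label s x \<in> S"
  by (cases s) (simp add: lab_in set_trail)

lemma step_legal: "s \<in> legal \<Longrightarrow> x \<in> words \<delta> \<Longrightarrow> step s x \<in> legal"
  using label_in[OF advance_legal] advance_legal[of s x] d_pos by (auto simp: step_def)

lemma label_step:
  assumes "(\<tau>, m) \<in> legal" "x \<in> words \<delta>"
  shows "label (step (\<tau>, m) x) x =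
    (if m = 0 \<and> looping (anc (Suc 0) x) then b (canon \<delta> d x)
     else lab \<tau> (canon \<delta> d x # trail m (anc (Suc 0) x)))"
proof -
  have "label (step (\<tau>, m) x) x = label (advance (\<tau>, m) x) x"
    using label_in[OF advance_legal[OF assms] assms(2)]
    by (simp add: step_def lab_Nil del: advance.simps)
  also have "\<dots> = (if m = 0 \<and> looping (anc (Suc 0) x) then b (canon \<delta> d x)
     else lab \<tau> (trail (Suc m) x))"
  proof -
    \<comment> \<open>The last level of a block is also the root of the next one; the uniform leaf
      labels make both readings agree.\<close>
    have "lab \<tau> (trail d x) = leaf_label (trail d x)"
      using assms by (intro lab_leaf) (auto simp: set_trail)
    moreover have "trail (Suc m) x = trail d x" if "\<not> Suc m < d"
    proof -
      have "Suc m = d" using that assms(1) by auto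
      then show ?thesis by simp
    qed
    ultimately show ?thesis
      using assms by (auto simp: lab_Nil b_in canon_less leaf_label_in)
  qed
  finally show ?thesis by (simp add: trail_Suc)
qed

text \<open>When looping, the children follow \<open>b_config\<close>, whose parent label is
  \<open>a\<close>; \<open>step_looping\<close> will supply the condition on \<tau>. Otherwise they
  follow the certificate tree.\<close>

lemma step_config:
  assumes "(\<tau>, m) \<in> legal" "x \<in> words \<delta>" "m = 0 \<Longrightarrow> looping x \<Longrightarrow> \<tau> = a"
  shows "perm_config P (label (\<tau>, m) x)
    (image_mset (\<lambda>q. label (step (\<tau>, m) (case_nat q x)) (case_nat q x)) (mset_set {..<\<delta>}))"
proof -
  define g where "g j = (if m = 0 \<and> looping x then b j else lab \<tau> (j # trail m x))" for j
  have "image_mset (\<lambda>q. label (step (\<tau>, m) (case_nat q x)) (case_nat q x)) (mset_set {..<\<delta>}) =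
    image_mset (\<lambda>q. g (canon \<delta> d (case_nat q x))) (mset_set {..<\<delta>})"
    by (intro image_mset_cong)
      (use assms case_nat_words in \<open>auto simp: label_step g_def\<close>)
  also have "\<dots> = image_mset g (mset_set {..<\<delta>})" using \<delta>_pos by (simp add: image_canon)
  moreover have "perm_config P (label (\<tau>, m) x) (image_mset g (mset_set {..<\<delta>}))"
  proof (cases "m = 0 \<and> looping x")
    case True
    then have "g = b" "\<tau> = a" using assms(3) by (auto simp: g_def)
    then show ?thesis using True b_config assms(1) by (simp add: lab_Nil)
  next
    case False
    then have "g = (\<lambda>j. lab \<tau> (j # trail m x))" by (auto simp: g_def)
    then show ?thesis using lab_config[of \<tau> "trail m x"] assms(1,2) by (simp add: set_trail)
  qed
  ultimately show ?thesis by simp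
qed

section \<open>Forgetting the initial state\<close>

text \<open>Here \<open>s\<close> is the state at the \<open>n\<close>-th ancestor, from which the
  automaton descends to the node itself.\<close>

primrec run :: "nat \<Rightarrow> 'l \<times> nat \<Rightarrow> (nat \<Rightarrow> nat) \<Rightarrow> 'l \<times> nat" where
  "run 0 s x = s"
| "run (Suc n) s x = step (run n s (anc (Suc 0) x)) x"

lemma run_add: "run (n + k) s x = run n (run k s (anc n x)) x"
  by (induction n arbitrary: x) simp_all

lemma run_legal: "s \<in> legal \<Longrightarrow> x \<in> words \<delta> \<Longrightarrow> run n s x \<in> legal"
  by (induction n arbitrary: x) (auto simp: step_legal anc_words simp del: mem_Times_iff)

lemma trail_looping: "x \<in> words \<delta> \<Longrightarrow> looping x \<Longrightarrow> trail d x = replicate d 0"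
  by (rule nth_equalityI)
    (auto simp: trail_def looping_def idle_def canon_heavy anc_words)

text \<open>Without a cut, level 0 arises either from the loop, where a heavy node takes
  \<open>b 0\<close>, or at the end of a block whose trail is all zeros. Both give
  \<open>a\<close>.\<close>

lemma step_looping:
  assumes "x \<in> words \<delta>" "looping x" "snd (step s x) = 0"
  shows "fst (step s x) = a"
proof -
  obtain \<tau> m where s: "s = (\<tau>, m)" by fastforce
  have "\<not> reset d x" "heavy d x" using looping_idle[OF assms(2)] by (auto simp: idle_def)
  then show ?thesis
    using assms trail_looping[OF assms(1,2)]
    by (auto simp: step_def s canon_heavy b_0 leaf_label_0 split: if_splits)
qed

text \<open>Without cuts the level grows until the block ends, and then the loop keeps it at 0. The
  \<open>d\<close> idle levels beyond \<open>j\<close> make all parents involved looping.\<close>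

lemma run_idle:
  assumes "\<And>i. i < d + j \<Longrightarrow> idle d (anc i x)" "m < d"
  shows "snd (run j (\<tau>, m) x) = 0 \<or> snd (run j (\<tau>, m) x) = m + j \<and> m + j < d"
  using assms(1)
proof (induction j arbitrary: x)
  case (Suc j)
  obtain \<tau>' m' where r: "run j (\<tau>, m) (anc (Suc 0) x) = (\<tau>', m')" by fastforce
  have "m' = 0 \<or> m' = m + j \<and> m + j < d"
    using Suc.IH[of "anc (Suc 0) x"] Suc.prems[of "Suc _"] r by auto
  moreover have "looping (anc (Suc 0) x)" using Suc.prems by (auto simp: looping_def)
  moreover have "\<not> reset d x" using Suc.prems[of 0] by (auto simp: idle_def)
  ultimately show ?case by (auto simp: r step_def)
qed (use assms(2) in simp)

lemma run_idle_state:
  assumes "\<And>i. i < 2 * d \<Longrightarrow> idle d (anc i x)" "x \<in> words \<delta>" "s \<in> legal" "n \<ge> d"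
  shows "run n s x = (a, 0)"
proof -
  \<comment> \<open>Only the last \<open>d\<close> steps count, since they bring any level to
    0.\<close>
  define k where "k = n - d"
  obtain \<tau> m where r: "run k s (anc d x) = (\<tau>, m)" by fastforce
  have m: "m < d" using run_legal[OF assms(3) anc_words[OF assms(2)], of k d] r by simp
  have n: "run n s x = run d (\<tau>, m) x"
    using run_add[of d k s x] assms(4) by (simp add: k_def r[unfolded k_def])
  have "snd (run n s x) = 0" using run_idle[of d x m \<tau>] assms(1) m n by simp
  moreover obtain n' where "n = Suc n'" using assms(4) d_pos by (cases n) auto
  moreover have "looping x" using assms(1) by (auto simp: looping_def)
  ultimately show ?thesis using step_looping[OF assms(2)] by (metis prod.collapse run.simps(2))
qed

lemma run_after_reset:
  assumes "reset d (anc j x)" "\<And>i. i < j \<Longrightarrow> \<not> reset d (anc i x)" "j < d"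
  shows "run j (\<tau>, 0) x = (\<tau>, j)"
  using assms
proof (induction j arbitrary: x)
  case (Suc j)
  have "run j (\<tau>, 0) (anc (Suc 0) x) = (\<tau>, j)" using Suc by simp
  \<comment> \<open>Directly below the cut the level is 0, but the cut node is not idle, so the loop
    is not entered.\<close>
  moreover have "\<not> (j = 0 \<and> looping (anc (Suc 0) x))"
    using Suc.prems(1) looping_idle by (auto simp: idle_def)
  moreover have "\<not> reset d x" using Suc.prems(2)[of 0] by simp
  ultimately show ?case using Suc.prems(3) by (auto simp: step_def)
qed simp

text \<open>By \<open>reset_gap\<close> the block after a cut is completed undisturbed, and its leaf
  label depends on the trail alone. The bound \<open>n > d\<close> ensures that the cut itself is
  read.\<close>

lemma run_reset_state:
  assumes "reset d (anc d x)" "n > d"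
  shows "run n s x = (leaf_label (trail d x), 0)"
proof -
  obtain e where e: "d = Suc e" using d_pos by (cases d) auto
  define k where "k = n - d - 1"
  have no: "\<not> reset d (anc i x)" if "i < d" for i
    using reset_gap[of d "anc i x" "d - i"] assms(1) that by (auto simp: Suc_le_eq)
  obtain \<tau> where "run (Suc k) s (anc d x) = (\<tau>, 0)" using assms(1) by (simp add: step_def)
  moreover have "run n s x = run d (run (Suc k) s (anc d x)) x"
    using run_add[of d "Suc k" s x] assms(2) by (simp add: k_def del: run.simps)
  ultimately have "run n s x = run d (\<tau>, 0) x" by simp
  also have "\<dots> = step (run e (\<tau>, 0) (anc (Suc 0) x)) x"
    using run.simps(2)[of e] unfolding e[symmetric] .
  also have "run e (\<tau>, 0) (anc (Suc 0) x) = (\<tau>, e)"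
    using assms(1) no e by (intro run_after_reset) auto
  also have "step (\<tau>, e) x = (leaf_label (trail d x), 0)"
  proof -
    have "\<not> (e = 0 \<and> looping (anc (Suc 0) x))"
      using assms(1) e looping_idle by (auto simp: idle_def)
    moreover have "\<not> reset d x" using no[of 0] d_pos by simp
    ultimately show ?thesis by (auto simp: step_def simp flip: e)
  qed
  finally show ?thesis .
qed

text \<open>The automaton forgets its initial state, which is what makes the labeling local.\<close>

lemma run_merge:
  "\<exists>N. \<forall>x\<in>words \<delta>. \<forall>s\<in>legal. \<forall>t\<in>legal. run N s x = run N t x"
proof -
  obtain K where K: "\<forall>x\<in>words \<delta>. \<exists>k\<le>K. reset d (anc k x) \<or> (\<forall>i<2 * d. idle d (anc (i + k) x))"
    using reset_or_idle[of \<delta> d] ..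
  \<comment> \<open>The search starts at the \<open>d\<close>-th ancestor, so that the block below a
    cut ends on the path. \<open>N\<close> is large enough for \<open>N - k > d\<close> in the cut
    case and \<open>N - (k + d) \<ge> d\<close> in the idle case.\<close>
  define N where "N = K + d + d + 1"
  have "run N s x = run N t x" if x: "x \<in> words \<delta>" and s: "s \<in> legal" and t: "t \<in> legal" for x s t
  proof -
    obtain k where k: "k \<le> K" and
      c: "reset d (anc d (anc k x)) \<or> (\<forall>i<2 * d. idle d (anc i (anc (k + d) x)))"
      using bspec[OF K anc_words[OF x, of d]] by (auto simp: add_ac)
    have "\<exists>m\<le>N. run (N - m) s (anc m x) = run (N - m) t (anc m x)"
      using c
    proof
      assume r: "reset d (anc d (anc k x))"
      have "d < N - k" "k \<le> N" using k by (auto simp: N_def)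
      then show ?thesis using run_reset_state[OF r] by metis
    next
      assume i: "\<forall>i<2 * d. idle d (anc i (anc (k + d) x))"
      have "d \<le> N - (k + d)" "k + d \<le> N" using k by (auto simp: N_def)
      then show ?thesis
        using run_idle_state[OF i[rule_format] anc_words[OF x]] s t by metis
    qed
    then obtain m where "m \<le> N" "run (N - m) s (anc m x) = run (N - m) t (anc m x)" by blast
    then show ?thesis
      using run_add[of m "N - m" s x] run_add[of m "N - m" t x] by simp
  qed
  then show ?thesis by (intro exI[of _ N] ballI)
qed

section \<open>Dependence on bounded windows\<close>

lemma trail_agree:
  "agree (2 * d + 1 + m) x y \<Longrightarrow> trail m x = trail m y"
  unfolding trail_def by (auto intro!: canon_agree agree_anc)

lemma looping_agree: "agree (5 * d + 1) x y \<Longrightarrow> looping x \<longleftrightarrow> looping y"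
  unfolding looping_def by (intro all_cong1 imp_cong refl idle_agree agree_anc) auto

text \<open>The widest window comes from the looping test at the parent: \<open>5 * d + 1\<close>
  letters after the first decide it.\<close>

lemma step_agree:
  assumes "agree (5 * d + 2) x y" "s \<in> legal"
  shows "step s x = step s y"
proof -
  obtain \<tau> m where s: "s = (\<tau>, m)" by fastforce
  have m: "m < d" using assms(2) s by simp
  have tr: "trail k x = trail k y" if "k \<le> d" for k
    using trail_agree[OF agree_mono[OF assms(1)]] that by simp
  have cn: "canon \<delta> d x = canon \<delta> d y" by (rule canon_agree, rule agree_mono[OF assms(1)]) simp
  have lp: "looping (anc (Suc 0) x) = looping (anc (Suc 0) y)"
    by (rule looping_agree, rule agree_anc[OF assms(1)]) simp
  have rs: "reset d x = reset d y" by (rule reset_agree, rule agree_mono[OF assms(1)]) simp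
  show ?thesis unfolding s step_def using tr m cn lp rs by (simp add: Suc_le_eq)
qed

lemma run_agree:
  assumes "agree (5 * d + 2 + n) x y" "s \<in> legal" "x \<in> words \<delta>" "y \<in> words \<delta>"
  shows "run n s x = run n s y"
  using assms
proof (induction n arbitrary: x y)
  case (Suc n)
  have "run n s (anc (Suc 0) x) = run n s (anc (Suc 0) y)"
    by (rule Suc.IH) (use Suc.prems in \<open>auto intro: agree_anc anc_words\<close>)
  moreover have "step t x = step t y" if "t \<in> legal" for t
    by (rule step_agree[OF agree_mono[OF Suc.prems(1)]]) (use that in auto)
  ultimately show ?case
    using run_legal[OF Suc.prems(2) anc_words[OF Suc.prems(4)]] by simp
qed simp

theorem local_labeling:
  "\<exists>K F. (\<forall>x\<in>words \<delta>. \<forall>y\<in>words \<delta>. agree K x y \<longrightarrow> F x = F y) \<and>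
     (\<forall>x\<in>words \<delta>. F x \<in> S \<and>
        perm_config P (F x) (image_mset (\<lambda>q. F (case_nat q x)) (mset_set {..<\<delta>})))"
proof -
  obtain N where N: "\<And>x s t. x \<in> words \<delta> \<Longrightarrow> s \<in> legal \<Longrightarrow> t \<in> legal \<Longrightarrow> run N s x = run N t x"
    using run_merge by blast
  define s where "s = (a, 0 :: nat)"
  have s: "s \<in> legal" using b_in[of 0] b_0 \<delta>_pos d_pos by (simp add: s_def)
  \<comment> \<open>An extra step at the top only replaces the initial state by another legal
    one.\<close>
  have Suc_N: "run N s x = run (Suc N) s x" if "x \<in> words \<delta>" for x
  proof -
    have "run (Suc N) s x = run N (run 1 s (anc N x)) x"
      using run_add[of N 1 s x] by simp
    also have "\<dots> = run N s x"
      by (rule N[OF that run_legal[OF s anc_words[OF that]] s])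
    finally show ?thesis by simp
  qed
  \<comment> \<open>With at least one step, the state at the node is a result of
    \<open>step\<close>, as \<open>step_looping\<close> requires.\<close>
  define N' where "N' = Suc N"
  define F where "F x = label (run N' s x) x" for x
  have "F x = F y" if "x \<in> words \<delta>" "y \<in> words \<delta>" "agree (5 * d + 2 + N') x y" for x y
  proof -
    obtain \<tau> m where r: "run N' s x = (\<tau>, m)" by fastforce
    have "m < d" using run_legal[OF s that(1), of N'] r by simp
    then have "trail m x = trail m y" by (intro trail_agree agree_mono[OF that(3)]) simp
    moreover have "run N' s y = (\<tau>, m)" using run_agree[OF that(3) s that(1,2)] r by simp
    ultimately show ?thesis using r by (simp add: F_def)
  qed
  moreover have "F x \<in> S \<and> perm_config P (F x) (image_mset (\<lambda>q. F (case_nat q x)) (mset_set {..<\<delta>}))"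
    if x: "x \<in> words \<delta>" for x
  proof
    show "F x \<in> S" unfolding F_def by (rule label_in[OF run_legal[OF s x] x])
    obtain \<tau> m where r: "run N' s x = (\<tau>, m)" by fastforce
    have leg: "(\<tau>, m) \<in> legal" using run_legal[OF s x, of N'] r by simp
    have "F (case_nat q x) = label (step (\<tau>, m) (case_nat q x)) (case_nat q x)" if "q < \<delta>" for q
    proof -
      let ?y = "case_nat q x"
      have "run (Suc N) s ?y = step (run N' s x) ?y"
        using Suc_N[OF x] by (simp add: N'_def)
      then show ?thesis unfolding F_def by (simp only: r flip: N'_def)
    qed
    then have "image_mset (\<lambda>q. F (case_nat q x)) (mset_set {..<\<delta>}) =
      image_mset (\<lambda>q. label (step (\<tau>, m) (case_nat q x)) (case_nat q x)) (mset_set {..<\<delta>})"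
      by (intro image_mset_cong) simp
    moreover have "\<tau> = a" if "m = 0" "looping x"
      using step_looping[OF x that(2), of "run N s (anc (Suc 0) x)"] r that(1)
      by (simp add: N'_def)
    ultimately show "perm_config P (F x) (image_mset (\<lambda>q. F (case_nat q x)) (mset_set {..<\<delta>}))"
      using step_config[OF leg x] by (simp add: F_def r)
  qed
  ultimately show ?thesis by blast
qed

end


section \<open>Collecting addresses\<close>

lemma mset_map_lift:
  "mset bs = image_mset f M \<Longrightarrow> \<exists>vs. mset vs = M \<and> map f vs = bs"
proof (induction bs arbitrary: M)
  case (Cons b bs)
  then have "image_mset f M = add_mset b (mset bs)" by simp
  from msed_map_invR[OF this] obtain M1 u where
    "M = add_mset u M1" "f u = b" "mset bs = image_mset f M1" by metis
  moreover from Cons.IH[OF this(3)] obtain vs where "mset vs = M1" "map f vs = bs" by blast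
  ultimately have "mset (u # vs) = M \<and> map f (u # vs) = b # bs" by simp
  then show ?case by (rule exI)
qed simp

lemma ordered_config_iff:
  assumes "finite A"
  shows "(\<exists>vs. distinct vs \<and> set vs = A \<and> (x, map f vs) \<in> configs P) \<longleftrightarrow>
    perm_config P x (image_mset f (mset_set A))"
proof
  assume "\<exists>vs. distinct vs \<and> set vs = A \<and> (x, map f vs) \<in> configs P"
  then obtain vs where "distinct vs" "set vs = A" "(x, map f vs) \<in> configs P" by blast
  then show "perm_config P x (image_mset f (mset_set A))"
    unfolding perm_config_def by (auto simp: mset_set_set)
next
  assume "perm_config P x (image_mset f (mset_set A))"
  then obtain bs where "(x, bs) \<in> configs P" "mset bs = image_mset f (mset_set A)"
    unfolding perm_config_def by blast
  moreover from mset_map_lift[OF this(2)] obtain vs where vs: "mset vs = mset_set A" "map f vs = bs"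
    by blast
  moreover have "set vs = A" using arg_cong[OF vs(1), of set_mset] assms by simp
  moreover have "distinct vs"
    using arg_cong[OF vs(1), of size] \<open>set vs = A\<close> by (intro card_distinct) simp
  ultimately show "\<exists>vs. distinct vs \<and> set vs = A \<and> (x, map f vs) \<in> configs P" by auto
qed

lemma image_mset_bij_betw:
  "bij_betw g A B \<Longrightarrow> image_mset (\<lambda>u. f (g u)) (mset_set A) = image_mset f (mset_set B)"
  using image_mset_mset_set[of g A]
  by (metis (no_types, lifting) bij_betw_def comp_apply image_mset_cong multiset.map_comp)

section \<open>Addresses in a network\<close>

lemma root_in_closed:
  assumes "rooted_tree G" "v \<in> verts G" "v \<in> A" "\<And>u. u \<in> A \<Longrightarrow> parent G u \<in> A"
  shows "root G \<in> A"
proof -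
  have "(parent G ^^ k) v \<in> A" for k by (induction k) (use assms(3,4) in auto)
  moreover obtain k where "(parent G ^^ k) v = root G"
    using assms(1,2) unfolding rooted_tree_def by blast
  ultimately show ?thesis by metis
qed

lemma finite_children: "rooted_tree G \<Longrightarrow> finite (children G v)"
  by (simp add: rooted_tree_def children_def)

lemma parent_in_verts: "rooted_tree G \<Longrightarrow> v \<in> verts G \<Longrightarrow> v \<noteq> root G \<Longrightarrow> parent G v \<in> verts G"
  by (simp add: rooted_tree_def)

text \<open>Otherwise \<open>{v, parent G v}\<close> would be closed under \<open>parent\<close>
  without containing the root.\<close>

lemma parent_notin_children:
  assumes "rooted_tree G" "v \<in> verts G" "v \<noteq> root G"
  shows "parent G v \<notin> children G v"
proof
  assume "parent G v \<in> children G v"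
  then have "parent G (parent G v) = v" "parent G v \<noteq> root G" by (auto simp: children_def)
  with root_in_closed[OF assms(1,2), of "{v, parent G v}"] assms(3) show False by auto
qed

definition parent_port_of :: "network \<Rightarrow> nat \<Rightarrow> nat option" where
  "parent_port_of N v =
     (if v = root (tree N) then None else Some (port_to N v (parent (tree N) v)))"

text \<open>Skipping the parent port renumbers the ports to the children without a gap.\<close>

definition rank :: "nat option \<Rightarrow> nat \<Rightarrow> nat" where
  "rank q p = (case q of None \<Rightarrow> p | Some q \<Rightarrow> if p < q then p else p - 1)"

text \<open>The port is the one at the parent, so a node learns its letter only through a message
  from the parent.\<close>

definition letter :: "network \<Rightarrow> nat \<Rightarrow> nat" where
  "letter N v = rank (parent_port_of N (parent (tree N) v)) (port_to N (parent (tree N) v) v)"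

primrec address_at :: "network \<Rightarrow> nat \<Rightarrow> nat \<Rightarrow> nat" where
  "address_at N 0 = (\<lambda>v. if v = root (tree N) then 0 else letter N v)"
| "address_at N (Suc i) =
     (\<lambda>v. if v = root (tree N) then 0 else address_at N i (parent (tree N) v))"

definition address :: "network \<Rightarrow> nat \<Rightarrow> nat \<Rightarrow> nat" where
  "address N v = (\<lambda>i. address_at N i v)"

lemma address_root: "address N (root (tree N)) = (\<lambda>_. 0)"
proof
  show "address N (root (tree N)) i = 0" for i by (cases i) (simp_all add: address_def)
qed

lemma address_nonroot:
  "v \<noteq> root (tree N) \<Longrightarrow> address N v = case_nat (letter N v) (address N (parent (tree N) v))"
  by (rule ext) (simp add: address_def split: nat.split)

locale network =
  fixes \<delta> c :: nat and N :: network
  assumes valid: "valid_network \<delta> c N" and \<delta>_pos: "\<delta> \<ge> 1"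
begin

abbreviation "G \<equiv> tree N"

lemma rooted: "rooted_tree G"
  using valid by (simp add: valid_network_def full_tree_def)

lemma port_to:
  assumes "v \<in> verts G" "w \<in> neighbours G v"
  shows "port_to N v w < degree G v" "port N v (port_to N v w) = w"
proof -
  have b: "bij_betw (port N v) {..<degree G v} (neighbours G v)"
    using valid assms(1) by (simp add: valid_network_def)
  have "w \<in> port N v ` {..<degree G v}" using bij_betw_imp_surj_on[OF b] assms(2) by simp
  then obtain p where p: "p < degree G v" "port N v p = w" by (auto elim!: imageE)
  have "\<exists>!p. p < degree G v \<and> port N v p = w"
    by (rule ex1I[of _ p]) (use p inj_onD[OF bij_betw_imp_inj_on[OF b]] in auto)
  from theI'[OF this] show "port_to N v w < degree G v" "port N v (port_to N v w) = w"
    by (auto simp: port_to_def)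
qed

text \<open>Ports to children are distinct and differ from the parent port, so \<open>rank\<close>
  is injective on them; equal cardinalities do the rest.\<close>

lemma letter_bij:
  assumes v: "v \<in> verts G" and card: "card (children G v) = \<delta>"
  shows "bij_betw (letter N) (children G v) {..<\<delta>}"
proof -
  let ?r = "\<lambda>u. rank (parent_port_of N v) (port_to N v u)"
  have l: "letter N u = ?r u" if "u \<in> children G v" for u
    using that by (simp add: letter_def children_def)
  have nb: "u \<in> neighbours G v" if "u \<in> children G v" for u
    using that by (simp add: neighbours_def)
  have inj: "u = w" if "u \<in> children G v" "w \<in> children G v" "port_to N v u = port_to N v w" for u w
    using port_to(2)[OF v nb] that by metis
  have "inj_on ?r (children G v) \<and> ?r ` children G v \<subseteq> {..<\<delta>}"
  proof (cases "v = root G")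
    case True
    then have "degree G v = \<delta>" using card by (simp add: degree_def neighbours_def)
    then show ?thesis
      using True port_to(1)[OF v nb] inj
      by (auto simp: inj_on_def parent_port_of_def rank_def)
  next
    case False
    let ?p = "parent G v"
    have p: "?p \<in> neighbours G v" using False by (simp add: neighbours_def)
    have notin: "?p \<notin> children G v" by (rule parent_notin_children[OF rooted v False])
    then have deg: "degree G v = Suc \<delta>"
      using False finite_children[OF rooted] by (simp add: degree_def neighbours_def card)
    define q where "q = port_to N v ?p"
    have ne: "port_to N v u \<noteq> q" if "u \<in> children G v" for u
      using port_to(2)[OF v nb[OF that]] port_to(2)[OF v p] that notin unfolding q_def by metis
    have le: "port_to N v u \<le> \<delta>" if "u \<in> children G v" for u
      using port_to(1)[OF v nb[OF that]] deg by simp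
    have q: "q \<le> \<delta>" using port_to(1)[OF v p] deg by (simp add: q_def)
    have r: "?r u = (if port_to N v u < q then port_to N v u else port_to N v u - 1)" for u
      using False by (simp add: parent_port_of_def rank_def q_def)
    have "inj_on ?r (children G v)"
    proof (rule inj_onI)
      fix u w assume uw: "u \<in> children G v" "w \<in> children G v" and "?r u = ?r w"
      then have "port_to N v u = port_to N v w"
        using ne[OF uw(1)] ne[OF uw(2)] unfolding r by (simp split: if_splits)
      then show "u = w" using inj uw by blast
    qed
    moreover have "?r u < \<delta>" if "u \<in> children G v" for u
      using ne[OF that] le[OF that] q unfolding r by auto
    ultimately show ?thesis by blast
  qed
  then have "inj_on (letter N) (children G v)" "letter N ` children G v \<subseteq> {..<\<delta>}"
    using l by (auto simp: inj_on_def)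
  then show ?thesis
    using card_subset_eq[of "{..<\<delta>}" "letter N ` children G v"] card
    by (simp add: bij_betw_def card_image)
qed

lemma letter_less:
  assumes "v \<in> verts G" "v \<noteq> root G"
  shows "letter N v < \<delta>"
proof -
  let ?p = "parent G v"
  have v: "v \<in> children G ?p" using assms by (simp add: children_def)
  have p: "?p \<in> verts G" using parent_in_verts[OF rooted assms] .
  have "card (children G ?p) \<noteq> 0" using v finite_children[OF rooted] by auto
  then have "card (children G ?p) = \<delta>" using valid p by (auto simp: valid_network_def full_tree_def)
  from bij_betw_imp_surj_on[OF letter_bij[OF p this]] v show ?thesis by blast
qed

lemma address_words: "v \<in> verts G \<Longrightarrow> address N v \<in> words \<delta>"
proof -
  have "v \<in> verts G \<Longrightarrow> address_at N i v < \<delta>" for i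
    by (induction i arbitrary: v)
      (use letter_less parent_in_verts[OF rooted] \<delta>_pos in auto)
  then show "v \<in> verts G \<Longrightarrow> address N v \<in> words \<delta>" by (simp add: words_def address_def)
qed

text \<open>Messages are only sent along edges, and an edge forces the logarithm in the bandwidth
  bound to be at least 1.\<close>

lemma two_verts:
  assumes "v \<in> verts G" "degree G v > 0"
  shows "card (verts G) \<ge> 2"
proof -
  have fin: "finite (verts G)" and r: "root G \<in> verts G" using rooted by (auto simp: rooted_tree_def)
  obtain u where u: "u \<in> neighbours G v" using assms(2) by (fastforce simp: degree_def)
  have "\<exists>w\<in>verts G. w \<noteq> root G"
    using u assms(1) by (auto simp: neighbours_def children_def split: if_splits)
  then obtain w where "w \<in> verts G" "w \<noteq> root G" by blast
  then have "card {w, root G} \<le> card (verts G)" using fin r by (intro card_mono) auto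
  then show ?thesis using \<open>w \<noteq> root G\<close> by simp
qed

text \<open>By \<open>letter_bij\<close> the addresses of the children run through all
  \<open>case_nat q x\<close> exactly once, so correctness on words transfers to nodes.\<close>

lemma address_solution:
  assumes "arity P = \<delta>"
    and F: "\<And>x. x \<in> words \<delta> \<Longrightarrow> F x \<in> labels P \<and>
      perm_config P (F x) (image_mset (\<lambda>q. F (case_nat q x)) (mset_set {..<\<delta>}))"
    and l: "\<And>v. v \<in> verts G \<Longrightarrow> l v = F (address N v)"
  shows "solution P G l"
  unfolding solution_def
proof (intro conjI ballI impI)
  fix v assume v: "v \<in> verts G"
  then show "l v \<in> labels P" using F address_words l by simp
  assume "card (children G v) = arity P"
  then have card: "card (children G v) = \<delta>" using assms(1) by simp
  have "image_mset l (mset_set (children G v)) =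
    image_mset (\<lambda>u. F (case_nat (letter N u) (address N v))) (mset_set (children G v))"
    using l finite_children[OF rooted]
    by (intro image_mset_cong) (auto simp: children_def address_nonroot)
  also have "\<dots> = image_mset (\<lambda>q. F (case_nat q (address N v))) (mset_set {..<\<delta>})"
    by (rule image_mset_bij_betw[OF letter_bij[OF v card]])
  finally show "\<exists>vs. distinct vs \<and> set vs = children G v \<and> (l v, map l vs) \<in> configs P"
    using F[OF address_words[OF v]] l[OF v]
    by (simp add: ordered_config_iff[OF finite_children[OF rooted]])
qed

end

section \<open>Collecting letters by messages\<close>

definition pad :: "nat list \<Rightarrow> nat \<Rightarrow> nat" where
  "pad xs i = (if i < length xs then xs ! i else 0)"

text \<open>A list \<open>xs\<close> is sent in unary, as \<open>to_nat xs\<close> bits. Only finitely many lists occur, so \<open>B\<close> can be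
  chosen such that the truncation to \<open>B\<close> bits, which bounds the bandwidth, never has an effect.\<close>

definition gather :: "nat \<Rightarrow> nat \<Rightarrow> ((nat \<Rightarrow> nat) \<Rightarrow> 'l) \<Rightarrow> (nat, 'l) algorithm" where
  "gather K B F =
     \<lparr> init = (\<lambda>info. to_nat (0 :: nat, parent_port info, [] :: nat list)),
       send = (\<lambda>s p. case from_nat s :: nat \<times> nat option \<times> nat list of (t, q, xs) \<Rightarrow>
          replicate (min B (to_nat (rank q p # xs))) True),
       update = (\<lambda>s ms. case from_nat s :: nat \<times> nat option \<times> nat list of (t, q, xs) \<Rightarrow>
          to_nat (Suc t, q,
            take K (case q of None \<Rightarrow> 0 # xs | Some p \<Rightarrow> from_nat (length (ms ! p))))),
       out = (\<lambda>s. case from_nat s :: nat \<times> nat option \<times> nat list of (t, q, xs) \<Rightarrow>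
          if t \<ge> K then Some (F (pad xs)) else None) \<rparr>"

lemma gather_simps [simp]:
  "init (gather K B F) info = to_nat (0 :: nat, parent_port info, [] :: nat list)"
  "send (gather K B F) (to_nat (t :: nat, q :: nat option, xs :: nat list)) p =
     replicate (min B (to_nat (rank q p # xs))) True"
  "update (gather K B F) (to_nat (t, q, xs)) ms =
     to_nat (Suc t, q, take K (case q of None \<Rightarrow> 0 # xs | Some p \<Rightarrow> from_nat (length (ms ! p))))"
  "out (gather K B F) (to_nat (t, q, xs)) = (if t \<ge> K then Some (F (pad xs)) else None)"
  by (simp_all add: gather_def)

context network
begin

text \<open>In each round the parent sends the letter of the child followed by its own prefix. This
  list has length at most \<open>Suc K\<close>, so by \<open>B\<close> it is not truncated.\<close>

lemma state_gather:
  assumes B: "\<And>xs. set xs \<subseteq> {..<\<delta>} \<Longrightarrow> length xs \<le> Suc K \<Longrightarrow> to_nat (xs :: nat list) \<le> B"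
  shows "v \<in> verts G \<Longrightarrow> state (gather K B F) N t v =
    to_nat (t, parent_port_of N v, map (address N v) [0..<min t K])"
proof (induction t arbitrary: v)
  case 0
  then show ?case by (simp add: local_info_def parent_port_of_def)
next
  case (Suc t)
  let ?A = "gather K B F"
  define n where "n = min t K"
  have n: "min (Suc t) K = min K (Suc n)" by (simp add: n_def)
  have take: "take K (address N v 0 # map (\<lambda>i. address N v (Suc i)) [0..<n]) =
      map (address N v) [0..<min (Suc t) K]"
    unfolding n map_upt_Suc[symmetric] take_map by (simp add: take_upt min_def del: upt_Suc)
  show ?case
  proof (cases "v = root G")
    case True
    \<comment> \<open>The root has no parent to listen to; prepending 0 continues the padding above
      it.\<close>
    then have "take K (0 # map (address N v) [0..<n]) = map (address N v) [0..<min (Suc t) K]"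
      using take by (simp add: address_root)
    then show ?thesis
      using Suc.IH[OF Suc.prems] True by (simp add: parent_port_of_def flip: n_def)
  next
    case False
    let ?p = "parent G v"
    define q where "q = port_to N v ?p"
    have p: "?p \<in> verts G" by (rule parent_in_verts[OF rooted Suc.prems False])
    have nb: "?p \<in> neighbours G v" using False by (simp add: neighbours_def)
    have q: "q < degree G v" "port N v q = ?p"
      using port_to[OF Suc.prems nb] by (auto simp: q_def)
    let ?msg = "letter N v # map (address N ?p) [0..<n]"
    have "set ?msg \<subseteq> {..<\<delta>}"
      using letter_less[OF Suc.prems False] address_words[OF p] by (auto simp: words_def)
    then have "to_nat ?msg \<le> B" by (intro B) (simp_all add: n_def)
    then have msg: "send ?A (state ?A N t ?p) (port_to N ?p v) = replicate (to_nat ?msg) True"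
      using Suc.IH[OF p] by (simp add: letter_def flip: n_def)
    have "state ?A N (Suc t) v = to_nat (Suc t, Some q, take K ?msg)"
      using Suc.IH[OF Suc.prems] False q msg
      by (simp add: parent_port_of_def flip: q_def)
    also have "?msg = address N v 0 # map (\<lambda>i. address N v (Suc i)) [0..<n]"
      using False by (simp add: address_nonroot)
    finally show ?thesis using take False by (simp add: parent_port_of_def q_def)
  qed
qed

lemma bandwidth_gather: "bandwidth_bounded (gather K B F) N B"
  unfolding bandwidth_bounded_def
proof (intro allI ballI impI)
  fix t v p assume v: "v \<in> verts G" "p < degree G v"
  have "length (send (gather K B F) (state (gather K B F) N t v) p) \<le> B"
    by (simp add: gather_def split: prod.split)
  moreover have "log 2 (real (card (verts G))) \<ge> 1"
    using two_verts[OF v(1)] v(2) by (subst le_log_iff) auto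
  then have "real B * 1 \<le> real B * log 2 (real (card (verts G)))" by (intro mult_left_mono) auto
  ultimately show "real (length (send (gather K B F) (state (gather K B F) N t v) p))
      \<le> real B * log 2 (real (card (verts G)))" by linarith
qed

end

lemma solvable_by_local_labeling:
  assumes \<delta>: "arity P = \<delta>" "\<delta> \<ge> 1"
    and loc: "\<And>x y. x \<in> words \<delta> \<Longrightarrow> y \<in> words \<delta> \<Longrightarrow> agree K x y \<Longrightarrow> F x = F y"
    and F: "\<And>x. x \<in> words \<delta> \<Longrightarrow> F x \<in> labels P \<and>
      perm_config P (F x) (image_mset (\<lambda>q. F (case_nat q x)) (mset_set {..<\<delta>}))"
  shows "congest_solvable_in P K"
proof -
  let ?W = "{xs. set xs \<subseteq> {..<\<delta>} \<and> length xs \<le> Suc K}"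
  define B where "B = Max (to_nat ` ?W)"
  have "finite (to_nat ` ?W)" by (intro finite_imageI finite_lists_length_le) simp
  then have B: "to_nat xs \<le> B" if "set xs \<subseteq> {..<\<delta>}" "length xs \<le> Suc K" for xs
    unfolding B_def by (rule Max_ge) (use that in blast)
  let ?A = "gather K B F"
  have "bandwidth_bounded ?A N B \<and> finishes_within ?A N K \<and> solution P (tree N) (output_label ?A N)"
    if "valid_network (arity P) c N" for c N
  proof -
    interpret network \<delta> c N using that \<delta> by unfold_locales auto
    have ho: "has_output ?A N t v \<longleftrightarrow> t \<ge> K" if "v \<in> verts G" for t v
      using state_gather[where K=K and F=F, OF B that] by (simp add: has_output_def)
    have "output_label ?A N v = F (address N v)" if v: "v \<in> verts G" for v
    proof -
      have "(LEAST t. has_output ?A N t v) = K"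
        by (rule Least_equality) (auto simp: ho[OF v])
      then have "output_label ?A N v = F (pad (map (address N v) [0..<K]))"
        using state_gather[where K=K and F=F and t=K, OF B v] by (simp add: output_label_def)
      \<comment> \<open>Zero padding keeps the collected prefix in \<open>words \<delta>\<close>,
        where locality of \<open>F\<close> applies.\<close>
      also have "\<dots> = F (address N v)"
        using address_words[OF v] \<delta>(2)
        by (intro loc) (auto simp: agree_def words_def pad_def)
      finally show ?thesis .
    qed
    from address_solution[OF \<delta>(1) F this]
    have "solution P (tree N) (output_label ?A N)" by simp
    moreover have "finishes_within ?A N K" using ho by (auto simp: finishes_within_def)
    ultimately show ?thesis using bandwidth_gather by blast
  qed
  then show ?thesis unfolding congest_solvable_in_def by blast
qed


section \<open>Canonical orders in the certificate trees\<close>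

lemma depth_root: "depth G (root G) = 0"
  by (simp add: depth_def)

lemma depth_child:
  assumes "rooted_tree G" "u \<in> children G v"
  shows "depth G u = Suc (depth G v)"
proof -
  obtain k where "(parent G ^^ k) u = root G"
    using assms by (auto simp: rooted_tree_def children_def)
  moreover have "(parent G ^^ 0) u \<noteq> root G" "parent G u = v" using assms by (auto simp: children_def)
  ultimately show ?thesis
    unfolding depth_def by (subst Least_Suc) (auto simp: funpow_swap1)
qed

lemma ancestor_depth:
  assumes "rooted_tree G" "v \<in> verts G" "k \<le> depth G v"
  shows "(parent G ^^ k) v \<in> verts G" "(parent G ^^ k) v = root G \<longleftrightarrow> k = depth G v"
proof -
  obtain j where "(parent G ^^ j) v = root G"
    using assms by (auto simp: rooted_tree_def)
  then have "(parent G ^^ depth G v) v = root G" unfolding depth_def by (rule LeastI)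
  moreover have ne: "(parent G ^^ i) v \<noteq> root G" if "i < depth G v" for i
    using not_less_Least[of i] that unfolding depth_def by blast
  ultimately show "(parent G ^^ k) v = root G \<longleftrightarrow> k = depth G v"
    using assms(3) by (metis le_neq_implies_less)
  show "(parent G ^^ k) v \<in> verts G"
    using assms(3)
  proof (induction k)
    case (Suc k)
    then show ?case using ne[of k] parent_in_verts[OF assms(1)] by simp
  qed (use assms(2) in simp)
qed

text \<open>Descending from an inner node ends in a leaf, which has depth \<open>d\<close>; the
  induction on the distance to the maximal depth expresses this descent.\<close>

lemma complete_tree_depth:
  assumes "complete_tree \<delta> d G" "v \<in> verts G"
  shows "depth G v \<le> d \<and> (leaf G v \<longleftrightarrow> depth G v = d)"
  using assms(2)
proof (induction "Max (depth G ` verts G) - depth G v" arbitrary: v rule: less_induct)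
  case less
  have r: "rooted_tree G" using assms(1) by (simp add: complete_tree_def)
  show ?case
  proof (cases "leaf G v")
    case True
    then show ?thesis using assms(1) by (simp add: complete_tree_def)
  next
    case False
    then obtain u where u: "u \<in> children G v" using less.prems by (auto simp: leaf_def)
    then have uv: "u \<in> verts G" by (simp add: children_def)
    have du: "depth G u = Suc (depth G v)" by (rule depth_child[OF r u])
    have "depth G u \<le> Max (depth G ` verts G)"
      using uv r by (intro Max_ge) (auto simp: rooted_tree_def)
    with less.hyps[OF _ uv] du have "depth G u \<le> d" by simp
    with False du show ?thesis by simp
  qed
qed

primrec walk :: "'v rtree \<Rightarrow> ('v \<Rightarrow> nat \<Rightarrow> 'v) \<Rightarrow> nat list \<Rightarrow> 'v" where
  "walk G e [] = root G"
| "walk G e (j # w) = e (walk G e w) j"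

lemma walk_depth:
  assumes G: "complete_tree \<delta> d G"
    and e: "\<And>v. v \<in> verts G \<Longrightarrow> \<not> leaf G v \<Longrightarrow> bij_betw (e v) {..<\<delta>} (children G v)"
  shows "set w \<subseteq> {..<\<delta>} \<Longrightarrow> length w \<le> d \<Longrightarrow> walk G e w \<in> verts G \<and> depth G (walk G e w) = length w"
proof (induction w)
  case Nil
  then show ?case using G by (simp add: depth_root complete_tree_def rooted_tree_def)
next
  case (Cons j w)
  let ?v = "walk G e w"
  have v: "?v \<in> verts G" "depth G ?v = length w" using Cons by auto
  then have "\<not> leaf G ?v" using complete_tree_depth[OF G] Cons.prems by auto
  from bij_betw_imp_surj_on[OF e[OF v(1) this]] Cons.prems have u: "e ?v j \<in> children G ?v" by auto
  then have "depth G (e ?v j) = Suc (depth G ?v)"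
    using G by (intro depth_child) (auto simp: complete_tree_def)
  then show ?case using u v by (simp add: children_def)
qed

lemma enumeration_starting_at:
  assumes "finite A" "card A = n" "x \<in> A"
  shows "\<exists>f. bij_betw f {..<n} A \<and> f 0 = x"
proof -
  obtain g where g: "bij_betw g {..<n} A"
    using ex_bij_betw_nat_finite[OF assms(1)] assms(2) by (auto simp: atLeast0LessThan)
  then obtain i where i: "i < n" "g i = x" using assms(3) by (auto simp: bij_betw_def)
  have "bij_betw (transpose 0 i) {..<n} {..<n}"
    using i(1) by (auto simp: bij_betw_def)
  from bij_betw_trans[OF this g] i show ?thesis by (intro exI[of _ "g \<circ> transpose 0 i"]) simp
qed

lemma enumeration_along_leaf:
  assumes G: "complete_tree \<delta> d G" and leaf: "leaf G z"
  shows "\<exists>e. (\<forall>v\<in>verts G. \<not> leaf G v \<longrightarrow> bij_betw (e v) {..<\<delta>} (children G v)) \<and>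
    walk G e (replicate d 0) = z"
proof -
  have r: "rooted_tree G" using G by (simp add: complete_tree_def)
  have z: "z \<in> verts G" "depth G z = d" using leaf G by (auto simp: leaf_def complete_tree_def)
  define up where "up k = (parent G ^^ k) z" for k
  \<comment> \<open>\<open>up (d - Suc (depth G v))\<close> is the ancestor of \<open>z\<close> one
    level below \<open>v\<close>; it is a child of \<open>v\<close> only if \<open>v\<close> lies on
    the path to \<open>z\<close>.\<close>
  have "\<exists>f. bij_betw f {..<\<delta>} (children G v) \<and>
      (up (d - Suc (depth G v)) \<in> children G v \<longrightarrow> f 0 = up (d - Suc (depth G v)))"
    if v: "v \<in> verts G" "\<not> leaf G v" for v
  proof -
    have c: "card (children G v) = \<delta>" using G v by (simp add: complete_tree_def)
    obtain u where u: "u \<in> children G v" using v by (auto simp: leaf_def)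
    let ?x = "if up (d - Suc (depth G v)) \<in> children G v then up (d - Suc (depth G v)) else u"
    have "?x \<in> children G v" using u by simp
    from enumeration_starting_at[OF finite_children[OF r] c this]
    obtain f where "bij_betw f {..<\<delta>} (children G v)" "f 0 = ?x" by blast
    then show ?thesis by (intro exI[of _ f]) simp
  qed
  then obtain e where e: "\<And>v. v \<in> verts G \<Longrightarrow> \<not> leaf G v \<Longrightarrow> bij_betw (e v) {..<\<delta>} (children G v) \<and>
      (up (d - Suc (depth G v)) \<in> children G v \<longrightarrow> e v 0 = up (d - Suc (depth G v)))"
    by metis
  have "i \<le> d \<Longrightarrow> walk G e (replicate i 0) = up (d - i) \<and> depth G (up (d - i)) = i" for i
  proof (induction i)
    case 0
    have "up d = root G" using ancestor_depth(2)[OF r z(1), of d] z(2) by (simp add: up_def)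
    then show ?case by (simp add: depth_root)
  next
    case (Suc i)
    let ?v = "up (d - i)" and ?u = "up (d - Suc i)"
    have v: "walk G e (replicate i 0) = ?v" "depth G ?v = i" using Suc by auto
    have vv: "?v \<in> verts G" using ancestor_depth(1)[OF r z(1)] z(2) by (simp add: up_def)
    have "\<not> leaf G ?v" using complete_tree_depth[OF G vv] v Suc.prems by simp
    moreover have "?u \<in> children G ?v"
    proof -
      have "?u \<in> verts G" "?u \<noteq> root G"
        using ancestor_depth[OF r z(1), of "d - Suc i"] z(2) Suc.prems by (auto simp: up_def)
      moreover have "d - i = Suc (d - Suc i)" using Suc.prems by simp
      then have "parent G ?u = ?v" by (simp add: up_def)
      ultimately show ?thesis by (simp add: children_def)
    qed
    ultimately show ?case using e[OF vv] v depth_child[OF r] by simp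
  qed
  from this[of d] have "walk G e (replicate d 0) = z" by (simp add: up_def)
  with e show ?thesis by blast
qed

lemma children_iso:
  assumes f: "bij_betw f (verts G) (verts H)" "f (root G) = root H"
    "\<forall>v\<in>verts G - {root G}. f (parent G v) = parent H (f v)"
    and G: "rooted_tree G" and v: "v \<in> verts G"
  shows "children H (f v) = f ` children G v"
proof
  have inj: "inj_on f (verts G)" and surj: "f ` verts G = verts H"
    using f(1) by (auto simp: bij_betw_def)
  show "f ` children G v \<subseteq> children H (f v)"
  proof
    fix y assume "y \<in> f ` children G v"
    then obtain u where u: "y = f u" "u \<in> verts G" "u \<noteq> root G" "parent G u = v"
      by (auto simp: children_def)
    moreover have "f u \<noteq> root H"
      using inj_onD[OF inj, of u "root G"] u f(2) G by (auto simp: rooted_tree_def)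
    ultimately show "y \<in> children H (f v)" using surj f(3) by (auto simp: children_def)
  qed
  show "children H (f v) \<subseteq> f ` children G v"
  proof
    fix y assume y: "y \<in> children H (f v)"
    then obtain u where u: "u \<in> verts G" "y = f u" using surj by (auto simp: children_def)
    then have "u \<noteq> root G" using y f(2) by (auto simp: children_def)
    moreover from this u have "f (parent G u) = f v" using f(3) y by (simp add: children_def)
    then have "parent G u = v"
      using inj_onD[OF inj] parent_in_verts[OF G u(1) calculation] v by blast
    ultimately show "y \<in> f ` children G v" using u by (auto simp: children_def)
  qed
qed

section \<open>From certificates to uniform families\<close>

text \<open>One tree with a leaf labeled \<open>a\<close> is ordered, and the isomorphisms carry
  this order to all trees, so that a word reaches corresponding nodes everywhere.\<close>

lemma uniform_family_of_certificate:
  assumes P: "lcl_problem P" and cert: "constant_certificate P S d \<T> lab (a, bs)"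
  shows "\<exists>lab' leaf_label b. uniform_family P (arity P) d S lab' leaf_label a b"
proof -
  let ?\<delta> = "arity P"
  have log: "log_star_certificate P S d \<T> lab" and conf: "(a, bs) \<in> configs P"
    and a: "a \<in> set bs" "insert a (set bs) \<subseteq> S"
    using cert by (auto simp: constant_certificate_def)
  obtain \<sigma>0 z where z: "\<sigma>0 \<in> S" "leaf (\<T> \<sigma>0) z" "lab \<sigma>0 z = a"
    using cert by (auto simp: constant_certificate_def)
  have len: "length bs = ?\<delta>" and \<delta>: "?\<delta> \<ge> 1" using P conf by (auto simp: lcl_problem_def)
  define G where "G = \<T> \<sigma>0"
  have G: "complete_tree ?\<delta> d G" using log z(1) by (simp add: log_star_certificate_def G_def)
  then have r: "rooted_tree G" by (simp add: complete_tree_def)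
  obtain e where e: "\<And>v. v \<in> verts G \<Longrightarrow> \<not> leaf G v \<Longrightarrow> bij_betw (e v) {..<?\<delta>} (children G v)"
    and ez: "walk G e (replicate d 0) = z"
    using enumeration_along_leaf[OF G] z(2) by (auto simp: G_def)
  have wd: "walk G e w \<in> verts G \<and> depth G (walk G e w) = length w"
    if "set w \<subseteq> {..<?\<delta>}" "length w \<le> d" for w
    using walk_depth[OF G e] that by blast
  have "\<forall>\<sigma>\<in>S. \<exists>f. bij_betw f (verts G) (verts (\<T> \<sigma>)) \<and> f (root G) = root (\<T> \<sigma>) \<and>
      (\<forall>v\<in>verts G - {root G}. f (parent G v) = parent (\<T> \<sigma>) (f v)) \<and>
      (\<forall>v\<in>verts G. erase_inner (\<T> \<sigma>) (lab \<sigma>) (f v) = erase_inner G (lab \<sigma>0) v)"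
    using log z(1) unfolding log_star_certificate_def labeled_iso_def G_def by blast
  from bchoice[OF this] obtain f where f: "\<And>\<sigma>. \<sigma> \<in> S \<Longrightarrow>
      bij_betw (f \<sigma>) (verts G) (verts (\<T> \<sigma>)) \<and> f \<sigma> (root G) = root (\<T> \<sigma>) \<and>
      (\<forall>v\<in>verts G - {root G}. f \<sigma> (parent G v) = parent (\<T> \<sigma>) (f \<sigma> v)) \<and>
      (\<forall>v\<in>verts G. erase_inner (\<T> \<sigma>) (lab \<sigma>) (f \<sigma> v) = erase_inner G (lab \<sigma>0) v)"
    by blast
  \<comment> \<open>One occurrence of \<open>a\<close> moves to index 0; the configuration is only
    permuted.\<close>
  define bs' where "bs' = a # remove1 a bs"
  have bs': "mset bs' = mset bs" using a(1) by (simp add: bs'_def)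
  then have len': "length bs' = ?\<delta>" using len by (metis size_mset)
  let ?lab = "\<lambda>\<sigma> w. lab \<sigma> (f \<sigma> (walk G e w))"
  have "uniform_family P ?\<delta> d S ?lab (\<lambda>w. lab \<sigma>0 (walk G e w)) a ((!) bs')"
  proof
    show "d \<ge> 1" using log by (simp add: log_star_certificate_def)
    show "?\<delta> \<ge> 1" by (rule \<delta>)
    show "?lab \<sigma> [] = \<sigma>" if "\<sigma> \<in> S" for \<sigma>
      using log f[OF that] that by (simp add: log_star_certificate_def)
    show "lab \<sigma>0 (walk G e (replicate d 0)) = a" by (simp add: ez z(3))
    show "bs' ! j \<in> S" if "j < ?\<delta>" for j
    proof -
      have "set bs' = set bs" using bs' by (rule mset_eq_setD)
      then show ?thesis using nth_mem[of j bs'] that len' a(2) by auto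
    qed
    show "bs' ! 0 = a" by (simp add: bs'_def)
    show "perm_config P a (image_mset ((!) bs') (mset_set {..<?\<delta>}))"
    proof -
      have "image_mset ((!) bs') (mset_set {..<?\<delta>}) = mset (map ((!) bs') [0..<length bs'])"
        by (simp add: len' lessThan_atLeast0)
      then show ?thesis using conf bs' by (auto simp: perm_config_def map_nth)
    qed
  next
    fix \<sigma> w assume \<sigma>: "\<sigma> \<in> S" and w: "set w \<subseteq> {..<?\<delta>}"
    let ?v = "walk G e w"
    note f\<sigma> = f[OF \<sigma>]
    {
      assume "length w \<le> d"
      then have "?v \<in> verts G" using wd[OF w] by simp
      then have "f \<sigma> ?v \<in> verts (\<T> \<sigma>)" using f\<sigma> by (auto simp: bij_betw_def)
      then show "?lab \<sigma> w \<in> S" using log \<sigma> by (simp add: log_star_certificate_def)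
    next
      assume l: "length w = d"
      then have v: "?v \<in> verts G" "leaf G ?v" using wd[OF w] complete_tree_depth[OF G] by auto
      \<comment> \<open>The erased labelings correspond, and the value \<open>Some\<close> already
        forces the image to be a leaf.\<close>
      then have "erase_inner (\<T> \<sigma>) (lab \<sigma>) (f \<sigma> ?v) = Some (lab \<sigma>0 ?v)"
        using f\<sigma> by (simp add: erase_inner_def)
      then show "?lab \<sigma> w = lab \<sigma>0 ?v" by (simp add: erase_inner_def split: if_splits)
    next
      assume l: "length w < d"
      then have v: "?v \<in> verts G" "\<not> leaf G ?v" using wd[OF w] complete_tree_depth[OF G] by auto
      let ?H = "\<T> \<sigma>" and ?C = "children G ?v"
      have fv: "f \<sigma> ?v \<in> verts ?H" using f\<sigma> v(1) by (auto simp: bij_betw_def)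
      have ch: "children ?H (f \<sigma> ?v) = f \<sigma> ` ?C" using children_iso[of "f \<sigma>"] f\<sigma> r v(1) by blast
      have "inj_on (f \<sigma>) (verts G)" using f\<sigma> by (simp add: bij_betw_def)
      then have inj: "inj_on (f \<sigma>) ?C" by (rule inj_on_subset) (auto simp: children_def)
      have "card ?C = ?\<delta>" using G v by (simp add: complete_tree_def)
      then have "card (children ?H (f \<sigma> ?v)) = ?\<delta>" by (simp add: ch card_image[OF inj])
      moreover have "solution P ?H (lab \<sigma>)" using log \<sigma> by (simp add: log_star_certificate_def)
      ultimately have "\<exists>vs. distinct vs \<and> set vs = f \<sigma> ` ?C \<and>
          (lab \<sigma> (f \<sigma> ?v), map (lab \<sigma>) vs) \<in> configs P"
        using fv unfolding solution_def ch[symmetric] by blast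
      then have "perm_config P (lab \<sigma> (f \<sigma> ?v)) (image_mset (lab \<sigma>) (mset_set (f \<sigma> ` ?C)))"
        by (subst (asm) ordered_config_iff) (simp_all add: finite_children[OF r])
      also have "image_mset (lab \<sigma>) (mset_set (f \<sigma> ` ?C)) =
          image_mset (\<lambda>u. lab \<sigma> (f \<sigma> u)) (mset_set ?C)"
        by (rule image_mset_bij_betw[symmetric]) (simp add: bij_betw_def inj)
      also have "\<dots> = image_mset (\<lambda>j. lab \<sigma> (f \<sigma> (e ?v j))) (mset_set {..<?\<delta>})"
        by (rule image_mset_bij_betw[OF e[OF v], symmetric])
      finally show "perm_config P (?lab \<sigma> w) (image_mset (\<lambda>j. ?lab \<sigma> (j # w)) (mset_set {..<?\<delta>}))"
        by simp
    }
  qed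
  then show ?thesis by blast
qed

theorem theorem7p2:
  fixes P :: "'l lcl"
  assumes "lcl_problem P"
    and "has_constant_certificate P"
  shows "\<exists>T. congest_solvable_in P T"
proof -
  obtain S d \<T> lab a bs where cert: "constant_certificate P S d \<T> lab (a, bs)"
    using assms(2) by (auto simp: has_constant_certificate_def)
  then obtain lab' leaf_label b where "uniform_family P (arity P) d S lab' leaf_label a b"
    using uniform_family_of_certificate[OF assms(1)] by blast
  then interpret uniform_family P "arity P" d S lab' leaf_label a b .
  have "S \<subseteq> labels P"
    using cert by (simp add: constant_certificate_def log_star_certificate_def)
  moreover obtain K F where
    "\<forall>x\<in>words (arity P). \<forall>y\<in>words (arity P). agree K x y \<longrightarrow> F x = F y"
    "\<forall>x\<in>words (arity P). F x \<in> S \<and>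
       perm_config P (F x) (image_mset (\<lambda>q. F (case_nat q x)) (mset_set {..<arity P}))"
    using local_labeling by blast
  ultimately have "congest_solvable_in P K"
    using \<delta>_pos by (intro solvable_by_local_labeling[of P "arity P" K F]) auto
  then show ?thesis ..
qed

end
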